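(* For all integers $n\ge 1$: the number of $\alpha\in\mathcal{DP}_{2n}$ with exactly one fixed point is $\frac{2(2^{2n}-1)}{3}$, and the number of $\alpha\in\mathcal{DP}_{2n-1}$ with exactly one fixed point is $\frac{2(2^{2n-2}-1)}{3}+2^{2n-2}$.
   Context: For a nonnegative integer $k$ let $X_k=\{1,2,\dots,k\}$ and let $\mathcal{I}_k$ be the set of all partial injective maps of $X_k$ (including the empty map). $\mathcal{DP}_k$ is the set of all $\alpha\in\mathcal{I}_k$ with $|x-y|=|x\alpha-y\alpha|$ for all $x,y\in\mathrm{Dom}\,\alpha$ (partial isometries; $x\alpha$ denotes the image of $x$ under $\alpha$). A fixed point of $\alpha$ is an $x\in\mathrm{Dom}\,\alpha$ with $x\alpha=x$. *)

theory Defs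
  imports Complex_Main
begin

definition X :: "nat \<Rightarrow> nat set" where
  "X k = {1..k}"

text \<open>Injectivity is required on the domain only, since every point outside it is sent to \<open>None\<close>.\<close>

definition partial_injections :: "nat \<Rightarrow> (nat \<rightharpoonup> nat) set" where
  "partial_injections k = {\<alpha>. dom \<alpha> \<subseteq> X k \<and> ran \<alpha> \<subseteq> X k \<and> inj_on \<alpha> (dom \<alpha>)}"

text \<open>Distances are taken in the integers because subtraction on the naturals truncates.\<close>

definition DP :: "nat \<Rightarrow> (nat \<rightharpoonup> nat) set" where
  "DP k = {\<alpha> \<in> partial_injections k. \<forall>x \<in> dom \<alpha>. \<forall>y \<in> dom \<alpha>.
     \<bar>int x - int y\<bar> = \<bar>int (the (\<alpha> x)) - int (the (\<alpha> y))\<bar>}"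

definition fixed_points :: "(nat \<rightharpoonup> nat) \<Rightarrow> nat set" where
  "fixed_points \<alpha> = {x \<in> dom \<alpha>. \<alpha> x = Some x}"

end

theory Submission imports Defs begin

text \<open>A partial isometry fixing \<open>p\<close> sends each \<open>x\<close> to \<open>x\<close> or to \<open>2p - x\<close>, so if \<open>p\<close> is its only
  fixed point, it is a restriction of the reflection at \<open>p\<close>. Its domain consists of \<open>p\<close> and an
  arbitrary set of points at distance between \<open>1\<close> and \<open>min (p - 1) (k - p)\<close> from \<open>p\<close>, which leaves
  \<open>4 ^ min (p - 1) (k - p)\<close> choices. Passing from \<open>k\<close> to \<open>k + 2\<close> multiplies the sum of these
  numbers over \<open>p\<close> by \<open>4\<close> and adds \<open>1\<close> at each end.\<close>

text \<open>The domain is passed explicitly because the point \<open>p\<close> and the domain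
  determine the map.\<close>

definition reflection_on :: "nat \<Rightarrow> nat set \<Rightarrow> nat \<rightharpoonup> nat" where
  "reflection_on p S = (\<lambda>x. if x \<in> S then Some (2 * p - x) else None)"

definition reflectable :: "nat \<Rightarrow> nat \<Rightarrow> nat set" where
  "reflectable k p = {p - min (p - 1) (k - p)..p + min (p - 1) (k - p)} - {p}"

lemma dom_reflection_on [simp]: "dom (reflection_on p S) = S"
  by (auto simp: reflection_on_def split: if_splits)

text \<open>The bounds \<open>x < 2 * p\<close> and \<open>2 * p - x \<le> k\<close> place the
  mirror image of \<open>x\<close> in \<open>X k\<close>; the construction and its converse both use
  this form.\<close>

lemma mem_reflectable_iff:
  assumes "p \<in> X k"
  shows "x \<in> reflectable k p \<longleftrightarrow> x \<in> X k \<and> x \<noteq> p \<and> x < 2 * p \<and> 2 * p - x \<le> k"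
  using assms by (auto simp: reflectable_def X_def min_def)

lemma card_Pow_reflectable:
  assumes "p \<in> X k"
  shows "card (Pow (reflectable k p)) = 4 ^ min (p - 1) (k - p)"
proof -
  define m where "m = min (p - 1) (k - p)"
  \<comment> \<open>This keeps the lower end \<open>p - m\<close> from truncating, so the interval
    has \<open>2 * m + 1\<close> points.\<close>
  have "m < p" using assms by (auto simp: m_def X_def)
  then have "card (reflectable k p) = 2 * m"
    unfolding reflectable_def m_def [symmetric] by (subst card_Diff_singleton) auto
  moreover have "finite (reflectable k p)" by (simp add: reflectable_def)
  ultimately show ?thesis by (simp add: card_Pow power_mult m_def)
qed

text \<open>Truncation adds no fixed point: \<open>x > 2 * p\<close> would give the value
  \<open>0\<close>, which differs from \<open>x\<close>.\<close>

lemma fixed_points_reflection_on: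
  assumes "p \<in> S"
  shows "fixed_points (reflection_on p S) = {p}"
  using assms by (auto simp: fixed_points_def reflection_on_def split: if_splits)

lemma reflection_on_in_DP:
  assumes "p \<in> X k" "A \<subseteq> reflectable k p"
  shows "reflection_on p (insert p A) \<in> DP k"
proof -
  \<comment> \<open>Below \<open>2 * p\<close> the subtraction is exact, so injectivity and
    preservation of distances are linear arithmetic.\<close>
  have S: "x \<in> X k \<and> x < 2 * p \<and> 2 * p - x \<le> k" if "x \<in> insert p A" for x
    using that assms mem_reflectable_iff [OF assms(1)] by (auto simp: X_def)
  have "inj_on (reflection_on p (insert p A)) (insert p A)"
  proof (rule inj_onI)
    fix x y
    assume "x \<in> insert p A" "y \<in> insert p A"
      and "reflection_on p (insert p A) x = reflection_on p (insert p A) y"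
    then have "2 * p - x = 2 * p - y" by (simp only: reflection_on_def if_True option.inject)
    then show "x = y" using S [OF \<open>x \<in> insert p A\<close>] S [OF \<open>y \<in> insert p A\<close>] by linarith
  qed
  moreover have "ran (reflection_on p (insert p A)) \<subseteq> X k"
  proof
    fix y
    assume "y \<in> ran (reflection_on p (insert p A))"
    then obtain x where "x \<in> insert p A" "y = 2 * p - x"
      by (auto simp: ran_def reflection_on_def split: if_splits)
    then show "y \<in> X k" using S [of x] by (auto simp: X_def)
  qed
  moreover have "insert p A \<subseteq> X k" using S by blast
  moreover have "\<bar>int x - int y\<bar> = \<bar>int (the (reflection_on p (insert p A) x))
      - int (the (reflection_on p (insert p A) y))\<bar>"
    if xy: "x \<in> insert p A" "y \<in> insert p A" for x y
  proof -
    have "the (reflection_on p (insert p A) x) = 2 * p - x"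
      "the (reflection_on p (insert p A) y) = 2 * p - y"
      using xy by (simp_all only: reflection_on_def if_True option.sel)
    then show ?thesis using S [OF xy(1)] S [OF xy(2)] by linarith
  qed
  ultimately show ?thesis
    by (simp only: DP_def partial_injections_def mem_Collect_eq dom_reflection_on) blast
qed

lemma DP_single_fixed_point:
  assumes "\<alpha> \<in> DP k" "fixed_points \<alpha> = {p}"
  shows "p \<in> X k" "dom \<alpha> - {p} \<subseteq> reflectable k p" "\<alpha> = reflection_on p (dom \<alpha>)"
proof -
  have p: "p \<in> dom \<alpha>" "\<alpha> p = Some p" using assms(2) by (auto simp: fixed_points_def)
  have dom: "dom \<alpha> \<subseteq> X k" and ran: "ran \<alpha> \<subseteq> X k"
    using assms(1) by (auto simp: DP_def partial_injections_def)
  show pX: "p \<in> X k" using p dom by blast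
  have val: "x < 2 * p \<and> 2 * p - x \<le> k \<and> \<alpha> x = Some (2 * p - x)" if x: "x \<in> dom \<alpha>" for x
  proof -
    obtain y where y: "\<alpha> x = Some y" using x by blast
    have "\<bar>int x - int p\<bar> = \<bar>int y - int p\<bar>"
      using assms(1) x p y by (simp add: DP_def)
    moreover have "y \<in> X k" using y ran by (auto intro: ranI)
    then have "1 \<le> y" "y \<le> k" by (simp_all add: X_def)
    \<comment> \<open>The distance to \<open>p\<close> leaves \<open>y = x\<close> or
      \<open>y = 2 * p - x\<close>; the first occurs only at \<open>p\<close>, where both agree.
      Then \<open>1 \<le> y\<close> gives \<open>x < 2 * p\<close>.\<close>
    moreover have "y = x \<longrightarrow> x = p" using assms(2) x y by (auto simp: fixed_points_def)
    ultimately have "y = 2 * p - x" "x < 2 * p" "2 * p - x \<le> k" by linarith+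
    then show ?thesis using y by simp
  qed
  show "dom \<alpha> - {p} \<subseteq> reflectable k p"
    using val dom mem_reflectable_iff [OF pX] by blast
  show "\<alpha> = reflection_on p (dom \<alpha>)"
    using val by (simp add: reflection_on_def fun_eq_iff domIff)
qed

lemma card_DP_single_fixed_point:
  "card {\<alpha> \<in> DP k. card (fixed_points \<alpha>) = 1} = (\<Sum>p = 1..k. 4 ^ min (p - 1) (k - p))"
proof -
  let ?f = "\<lambda>(p, A). reflection_on p (insert p A)"
  let ?D = "SIGMA p : X k. Pow (reflectable k p)"
  have "bij_betw ?f ?D {\<alpha> \<in> DP k. card (fixed_points \<alpha>) = 1}"
  proof (rule bij_betwI')
    fix u v
    assume u: "u \<in> ?D" and v: "v \<in> ?D"
    obtain p A q B where [simp]: "u = (p, A)" "v = (q, B)" by (metis surj_pair)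
    have "p = q \<and> A = B" if eq: "?f u = ?f v"
    proof -
      from eq have e: "reflection_on p (insert p A) = reflection_on q (insert q B)" by simp
      \<comment> \<open>The map determines \<open>p\<close> as its fixed point and
        \<open>insert p A\<close> as its domain; since \<open>p \<notin> A\<close>, it determines
        \<open>A\<close> too.\<close>
      then have "{p} = {q}" by (metis fixed_points_reflection_on insertI1)
      moreover have "insert p A = insert q B" using e by (metis dom_reflection_on)
      moreover have "p \<notin> A" "q \<notin> B" using u v by (auto simp: reflectable_def)
      ultimately show ?thesis by (metis insert_ident singleton_inject)
    qed
    then show "(?f u = ?f v) = (u = v)" by auto
  next
    fix u
    assume "u \<in> ?D"
    then show "?f u \<in> {\<alpha> \<in> DP k. card (fixed_points \<alpha>) = 1}"
      by (auto simp: reflection_on_in_DP fixed_points_reflection_on)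
  next
    fix \<alpha>
    assume "\<alpha> \<in> {\<alpha> \<in> DP k. card (fixed_points \<alpha>) = 1}"
    then obtain p where a: "\<alpha> \<in> DP k" "fixed_points \<alpha> = {p}" by (auto simp: card_1_singleton_iff)
    then have "p \<in> dom \<alpha>" by (auto simp: fixed_points_def)
    then have "\<alpha> = ?f (p, dom \<alpha> - {p})"
      using DP_single_fixed_point(3) [OF a] by (simp add: insert_absorb)
    moreover have "(p, dom \<alpha> - {p}) \<in> ?D" using DP_single_fixed_point [OF a] by simp
    ultimately show "\<exists>u \<in> ?D. \<alpha> = ?f u" by blast
  qed
  then have "card {\<alpha> \<in> DP k. card (fixed_points \<alpha>) = 1} = card ?D"
    by (simp add: bij_betw_same_card)
  also have "\<dots> = (\<Sum>p \<in> X k. card (Pow (reflectable k p)))"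
    by (rule card_SigmaI) (auto simp: X_def reflectable_def)
  also have "\<dots> = (\<Sum>p \<in> X k. 4 ^ min (p - 1) (k - p))"
    by (intro sum.cong refl card_Pow_reflectable)
  finally show ?thesis by (simp add: X_def)
qed

lemma sum_power_min_Suc_Suc:
  fixes c :: "'a :: comm_semiring_1"
  shows "(\<Sum>p = 1..Suc (Suc k). c ^ min (p - 1) (Suc (Suc k) - p))
    = 2 + c * (\<Sum>p = 1..k. c ^ min (p - 1) (k - p))"
proof -
  have "(\<Sum>p = 1..Suc (Suc k). c ^ min (p - 1) (Suc (Suc k) - p))
      = 1 + ((\<Sum>p = Suc 1..Suc k. c ^ min (p - 1) (Suc (Suc k) - p)) + 1)"
    by (simp add: sum.atLeast_Suc_atMost ac_simps)
  also have "(\<Sum>p = Suc 1..Suc k. c ^ min (p - 1) (Suc (Suc k) - p))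
      = (\<Sum>p = 1..k. c ^ min p (Suc k - p))"
    by (simp only: sum.shift_bounds_cl_Suc_ivl diff_Suc_1 diff_Suc_Suc)
  also have "\<dots> = (\<Sum>p = 1..k. c * c ^ min (p - 1) (k - p))"
  proof (rule sum.cong [OF refl])
    fix p
    assume "p \<in> {1..k}"
    \<comment> \<open>Since \<open>1 \<le> p\<close> and \<open>p \<le> k\<close>, no subtraction
      truncates and both arguments of \<open>min\<close> drop by exactly one.\<close>
    then have "min p (Suc k - p) = Suc (min (p - 1) (k - p))" by auto
    then show "c ^ min p (Suc k - p) = c * c ^ min (p - 1) (k - p)" by simp
  qed
  finally show ?thesis by (simp add: sum_distrib_left algebra_simps flip: one_add_one)
qed

text \<open>The factor \<open>3\<close> avoids division; the recurrence
  \<open>s \<mapsto> 2 + 4 * s\<close> starts from the empty sum.\<close>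

lemma sum_power4_min_even:
  "3 * (\<Sum>p = 1..2 * m. (4::real) ^ min (p - 1) (2 * m - p)) = 2 * (4 ^ m - 1)"
proof (induction m)
  case (Suc m)
  have "2 * Suc m = Suc (Suc (2 * m))" by simp
  then show ?case using Suc by (simp only: sum_power_min_Suc_Suc) simp
qed simp

text \<open>The same recurrence, now started from the single term \<open>1\<close> at size
  \<open>1\<close>, which accounts for the extra \<open>3 * 4 ^ m\<close>.\<close>

lemma sum_power4_min_odd:
  "3 * (\<Sum>p = 1..Suc (2 * m). (4::real) ^ min (p - 1) (Suc (2 * m) - p)) = 2 * (4 ^ m - 1) + 3 * 4 ^ m"
proof (induction m)
  case (Suc m)
  have "Suc (2 * Suc m) = Suc (Suc (Suc (2 * m)))" by simp
  then show ?case using Suc by (simp only: sum_power_min_Suc_Suc) simp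
qed simp

theorem proposition3p19:
  fixes n :: nat
  assumes "n \<ge> 1"
  shows "real (card {\<alpha> \<in> DP (2 * n). card (fixed_points \<alpha>) = 1}) = 2 * (2 ^ (2 * n) - 1) / 3
    \<and> real (card {\<alpha> \<in> DP (2 * n - 1). card (fixed_points \<alpha>) = 1})
        = 2 * (2 ^ (2 * n - 2) - 1) / 3 + 2 ^ (2 * n - 2)"
proof -
  \<comment> \<open>With \<open>n\<close> positive, the odd size \<open>2 * n - 1\<close> takes the
    form \<open>Suc (2 * m)\<close>.\<close>
  obtain m where n: "n = Suc m" using assms by (cases n) auto
  have "2 * n - 1 = Suc (2 * m)" "2 * n - 2 = 2 * m" by (simp_all add: n)
  moreover have "(2::real) ^ (2 * j) = 4 ^ j" for j by (simp add: power_mult)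
  ultimately show ?thesis
    using sum_power4_min_even [of n] sum_power4_min_odd [of m]
    by (simp only: card_DP_single_fixed_point of_nat_sum of_nat_power of_nat_numeral) linarith
qed

end
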